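(* Let $I\subset[0,\infty)$ be an interval, let $a,b\in I$ with $a<b$, and let $f:I\to\mathbb{R}$ be differentiable on the interior $I^{\circ}$ of $I$ and at $a$ and $b$, with $f'\in L[a,b]$. Let $p>1$, $\frac1p+\frac1q=1$, let $s\in(0,1]$ be fixed, and suppose that $|f'|^q$ is $s$-convex in the second sense on $[a,b]$. Then for each $x\in[a,b]$, $$\left|f(x)-\frac{1}{b-a}\int_a^b f(u)\,du\right|\le \frac{b-a}{(p+1)^{1/p}(s+1)^{1/q}}\Big\{\Big(\tfrac{b-x}{b-a}\Big)^{1+\frac1p}\Big(\Big(\tfrac{b-x}{b-a}\Big)^{s+1}|f'(a)|^q+\Big[1-\Big(\tfrac{x-a}{b-a}\Big)^{s+1}\Big]|f'(b)|^q\Big)^{\frac1q}+\Big(\tfrac{x-a}{b-a}\Big)^{1+\frac1p}\Big(\Big[1-\Big(\tfrac{b-x}{b-a}\Big)^{s+1}\Big]|f'(a)|^q+\Big(\tfrac{x-a}{b-a}\Big)^{s+1}|f'(b)|^q\Big)^{\frac1q}\Big\}.$$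
   Context: For fixed $s\in(0,1]$, a real function $g$ is $s$-convex in the second sense on $[a,b]\subset[0,\infty)$ if $g(\alpha x+(1-\alpha)y)\le \alpha^s g(x)+(1-\alpha)^s g(y)$ for all $x,y\in[a,b]$ and $\alpha\in[0,1]$. $L[a,b]$ denotes the Lebesgue integrable functions on $[a,b]$. If $a$ or $b$ is an endpoint of $I$, differentiability there is one-sided (within $I$). *)

theory Defs
  imports "HOL-Analysis.Analysis"
begin

text \<open>
  The definition is meant for \<open>0 < s \<le> 1\<close> and \<open>A \<subseteq> {0..}\<close>; since \<open>0 powr s = 0\<close>, the real power
  agrees with the usual convention \<open>0\<^sup>s = 0\<close> for \<open>s > 0\<close> when \<open>\<alpha>\<close> is 0 or 1.
\<close>

definition s_convex_on :: "real \<Rightarrow> real set \<Rightarrow> (real \<Rightarrow> real) \<Rightarrow> bool" where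
  "s_convex_on s A g \<longleftrightarrow>
     (\<forall>x\<in>A. \<forall>y\<in>A. \<forall>\<alpha>\<in>{0..1}.
        g (\<alpha> * x + (1 - \<alpha>) * y) \<le> \<alpha> powr s * g x + (1 - \<alpha>) powr s * g y)"

end

theory Submission
  imports Defs
begin

text \<open>
  Integrating the derivatives of \<open>(u - a) * f u\<close> and \<open>(b - u) * f u\<close> over \<open>{a..x}\<close> and \<open>{x..b}\<close>
  gives Montgomery's identity
  \<open>(b - a) * f x - integral {a..b} f
    = integral {a..x} (\<lambda>u. (u - a) * f' u) - integral {x..b} (\<lambda>u. (b - u) * f' u)\<close>.
  By \<open>s\<close>-convexity, \<open>\<bar>f' u\<bar> powr q\<close> is dominated by the continuous function
  \<open>((b - u) / (b - a)) powr s * \<bar>f' a\<bar> powr q + ((u - a) / (b - a)) powr s * \<bar>f' b\<bar> powr q\<close>, so each of the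
  two integrals can be estimated by Hoelder's inequality for continuous functions.
\<close>

section \<open>Hoelder's inequality for continuous functions\<close>

text \<open>Integrate Young's inequality for the normalised functions \<open>g / \<alpha>\<close>
  and \<open>h / \<beta>\<close>. Continuity makes every integrand integrable and settles the case
  in which a norm vanishes.\<close>

lemma Holder_integral_continuous:
  fixes g h :: "real \<Rightarrow> real"
  assumes "c \<le> d" and "p > 1" and "q > 1" and pq: "1 / p + 1 / q = 1"
    and g: "continuous_on {c..d} g" and h: "continuous_on {c..d} h"
    and g0: "\<And>u. u \<in> {c..d} \<Longrightarrow> 0 \<le> g u" and h0: "\<And>u. u \<in> {c..d} \<Longrightarrow> 0 \<le> h u"
  shows "integral {c..d} (\<lambda>u. g u * h u) \<le>
    integral {c..d} (\<lambda>u. g u powr p) powr (1 / p) * integral {c..d} (\<lambda>u. h u powr q) powr (1 / q)"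
proof (cases "c = d")
  case False
  with \<open>c \<le> d\<close> have "c < d" by simp
  define A where "A = integral {c..d} (\<lambda>u. g u powr p)"
  define B where "B = integral {c..d} (\<lambda>u. h u powr q)"
  have cg: "continuous_on {c..d} (\<lambda>u. g u powr p)"
    using g g0 \<open>p > 1\<close> by (intro continuous_on_powr') auto
  have ch: "continuous_on {c..d} (\<lambda>u. h u powr q)"
    using h h0 \<open>q > 1\<close> by (intro continuous_on_powr') auto
  have igh: "(\<lambda>u. g u * h u) integrable_on {c..d}"
    by (intro integrable_continuous_real continuous_intros g h)
  have A0: "A \<ge> 0" and B0: "B \<ge> 0"
    unfolding A_def B_def
    by (auto intro!: integral_nonneg integrable_continuous_real cg ch)
  show ?thesis
  proof (cases "A = 0 \<or> B = 0")
    case True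
    \<comment> \<open>A nonnegative continuous function with integral 0 on a nondegenerate interval
      vanishes there, so \<open>g\<close> or \<open>h\<close> is identically 0.\<close>
    have "g u * h u = 0" if "u \<in> {c..d}" for u
      using True integral_eq_0_iff[OF cg \<open>c < d\<close>] integral_eq_0_iff[OF ch \<open>c < d\<close>] that
      unfolding A_def B_def by auto
    then have "integral {c..d} (\<lambda>u. g u * h u) = integral {c..d} (\<lambda>u. 0)"
      by (intro integral_cong) auto
    then show ?thesis by simp
  next
    case False
    with A0 B0 have "A > 0" "B > 0" by auto
    \<comment> \<open>Dividing by these norms makes the integrals of the \<open>p\<close>-th and
      \<open>q\<close>-th powers equal to 1, so Young's bound integrates to
      \<open>1 / p + 1 / q = 1\<close>.\<close>
    define \<alpha> where "\<alpha> = A powr (1 / p)"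
    define \<beta> where "\<beta> = B powr (1 / q)"
    have pos: "\<alpha> > 0" "\<beta> > 0"
      using \<open>A > 0\<close> \<open>B > 0\<close> by (auto simp: \<alpha>_def \<beta>_def)
    have pw: "\<alpha> powr p = A" "\<beta> powr q = B"
      using \<open>A > 0\<close> \<open>B > 0\<close> \<open>p > 1\<close> \<open>q > 1\<close> by (auto simp: \<alpha>_def \<beta>_def powr_powr)
    have young: "(g u * h u) / (\<alpha> * \<beta>) \<le> g u powr p / (A * p) + h u powr q / (B * q)"
      if "u \<in> {c..d}" for u
      using Youngs_inequality[OF \<open>p > 1\<close> \<open>q > 1\<close> pq, of "g u / \<alpha>" "h u / \<beta>"] g0[OF that] h0[OF that] pos pw
      by (simp add: powr_divide)
    have "integral {c..d} (\<lambda>u. (g u * h u) / (\<alpha> * \<beta>))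
      \<le> integral {c..d} (\<lambda>u. g u powr p / (A * p) + h u powr q / (B * q))"
      using young
      by (intro integral_le integrable_add integrable_on_divide igh integrable_continuous_real[OF cg]
          integrable_continuous_real[OF ch]) auto
    also have "\<dots> = A / (A * p) + B / (B * q)"
      unfolding A_def B_def
      by (subst integral_add)
        (auto intro!: integrable_on_divide integrable_continuous_real[OF cg]
          integrable_continuous_real[OF ch])
    also have "\<dots> = 1"
      using \<open>A > 0\<close> \<open>B > 0\<close> pq by simp
    finally show ?thesis
      using pos by (simp add: \<alpha>_def \<beta>_def A_def B_def)
  qed
qed simp

section \<open>Integrals of shifted and reflected powers\<close>

lemma has_integral_powr_shift:
  fixes a c d r :: real
  assumes "a \<le> c" "c \<le> d" "r > 0"
  shows "((\<lambda>u. (u - a) powr r) has_integral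
    (d - a) powr (r + 1) / (r + 1) - (c - a) powr (r + 1) / (r + 1)) {c..d}"
\<comment> \<open>The derivative rule for \<open>powr\<close> wants a positive base, which fails at
  \<open>u = a\<close> when \<open>c = a\<close>; the interior form asks only for continuity at the
  endpoints.\<close>
proof (rule fundamental_theorem_of_calculus_interior[OF \<open>c \<le> d\<close>])
  show "continuous_on {c..d} (\<lambda>u. (u - a) powr (r + 1) / (r + 1))"
    using assms by (intro continuous_intros continuous_on_powr') auto
next
  fix u assume "u \<in> {c<..<d}"
  then show "((\<lambda>u. (u - a) powr (r + 1) / (r + 1)) has_vector_derivative (u - a) powr r) (at u)"
    using assms unfolding has_real_derivative_iff_has_vector_derivative[symmetric]
    by (auto intro!: derivative_eq_intros)
qed

lemma has_integral_powr_reflect: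
  fixes b c d r :: real
  assumes "c \<le> d" "d \<le> b" "r > 0"
  shows "((\<lambda>u. (b - u) powr r) has_integral
    (b - c) powr (r + 1) / (r + 1) - (b - d) powr (r + 1) / (r + 1)) {c..d}"
proof -
  have "((\<lambda>u. (b - u) powr r) has_integral
    - ((b - d) powr (r + 1) / (r + 1)) - - ((b - c) powr (r + 1) / (r + 1))) {c..d}"
  proof (rule fundamental_theorem_of_calculus_interior[OF \<open>c \<le> d\<close>])
    show "continuous_on {c..d} (\<lambda>u. - ((b - u) powr (r + 1) / (r + 1)))"
      using assms by (intro continuous_intros continuous_on_powr') auto
  next
    fix u assume "u \<in> {c<..<d}"
    then show "((\<lambda>u. - ((b - u) powr (r + 1) / (r + 1))) has_vector_derivative (b - u) powr r) (at u)"
      using assms unfolding has_real_derivative_iff_has_vector_derivative[symmetric]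
      by (auto intro!: derivative_eq_intros)
  qed
  then show ?thesis by simp
qed

section \<open>Montgomery's identity\<close>

text \<open>Product rule for \<open>(u - k) * f u\<close>, minus the integral of the continuous
  \<open>f\<close>. The free \<open>k\<close> serves both weights, with \<open>k = a\<close> and
  \<open>k = b\<close>.\<close>

lemma has_integral_linear_weight_deriv:
  fixes f f' :: "real \<Rightarrow> real"
  assumes "c \<le> d"
    and f: "\<And>u. u \<in> {c..d} \<Longrightarrow> (f has_real_derivative f' u) (at u within {c..d})"
  shows "((\<lambda>u. (u - k) * f' u) has_integral
    (d - k) * f d - (c - k) * f c - integral {c..d} f) {c..d}"
proof -
  have "continuous_on {c..d} f"
    using f by (rule DERIV_continuous_on)
  then have fi: "(f has_integral integral {c..d} f) {c..d}"
    by (intro integrable_integral integrable_continuous_real)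
  have "((\<lambda>u. f u + (u - k) * f' u) has_integral (d - k) * f d - (c - k) * f c) {c..d}"
  proof (rule fundamental_theorem_of_calculus[OF \<open>c \<le> d\<close>])
    fix u assume "u \<in> {c..d}"
    from f[OF this]
    show "((\<lambda>u. (u - k) * f u) has_vector_derivative f u + (u - k) * f' u) (at u within {c..d})"
      unfolding has_real_derivative_iff_has_vector_derivative[symmetric]
      by (auto intro!: derivative_eq_intros)
  qed
  from has_integral_diff[OF this fi] show ?thesis
    by simp
qed

text \<open>The boundary terms at \<open>a\<close> and \<open>b\<close> vanish because each weight
  is zero there; those at \<open>x\<close> add up to \<open>(b - a) * f x\<close>. Integrability is
  recorded for the later estimate.\<close>

lemma Montgomery_identity:
  fixes f f' :: "real \<Rightarrow> real"
  assumes "x \<in> {a..b}"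
    and f: "\<And>u. u \<in> {a..b} \<Longrightarrow> (f has_real_derivative f' u) (at u within {a..b})"
  shows "(\<lambda>u. (u - a) * f' u) integrable_on {a..x}"
    and "(\<lambda>u. (b - u) * f' u) integrable_on {x..b}"
    and "(b - a) * f x - integral {a..b} f =
      integral {a..x} (\<lambda>u. (u - a) * f' u) - integral {x..b} (\<lambda>u. (b - u) * f' u)"
proof -
  have ax: "((\<lambda>u. (u - a) * f' u) has_integral
      (x - a) * f x - (a - a) * f a - integral {a..x} f) {a..x}"
    using assms(1) by (intro has_integral_linear_weight_deriv DERIV_subset[OF f]) auto
  have "((\<lambda>u. (u - b) * f' u) has_integral
      (b - b) * f b - (x - b) * f x - integral {x..b} f) {x..b}"
    using assms(1) by (intro has_integral_linear_weight_deriv DERIV_subset[OF f]) auto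
  from has_integral_neg[OF this]
  have xb: "((\<lambda>u. (b - u) * f' u) has_integral integral {x..b} f - (b - x) * f x) {x..b}"
    by (simp add: algebra_simps)
  have "continuous_on {a..b} f"
    using f by (rule DERIV_continuous_on)
  then have split: "integral {a..x} f + integral {x..b} f = integral {a..b} f"
    using assms(1) by (intro Henstock_Kurzweil_Integration.integral_combine integrable_continuous_real) auto
  show "(\<lambda>u. (u - a) * f' u) integrable_on {a..x}" "(\<lambda>u. (b - u) * f' u) integrable_on {x..b}"
    using ax xb by blast+
  show "(b - a) * f x - integral {a..b} f =
      integral {a..x} (\<lambda>u. (u - a) * f' u) - integral {x..b} (\<lambda>u. (b - u) * f' u)"
    using integral_unique[OF ax] integral_unique[OF xb] split by (simp add: algebra_simps)
qed

section \<open>The majorant from \<open>s\<close>-convexity and the weighted estimate\<close>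

lemma has_integral_s_convex_majorant:
  fixes a b c d s A B :: real
  assumes "a < b" "a \<le> c" "c \<le> d" "d \<le> b" "s > 0"
  shows "((\<lambda>u. ((b - u) / (b - a)) powr s * A + ((u - a) / (b - a)) powr s * B) has_integral
    (b - a) / (s + 1) *
      ((((b - c) / (b - a)) powr (s + 1) - ((b - d) / (b - a)) powr (s + 1)) * A
       + (((d - a) / (b - a)) powr (s + 1) - ((c - a) / (b - a)) powr (s + 1)) * B)) {c..d}"
proof -
  have "((\<lambda>u. (b - u) powr s * (A / (b - a) powr s) + (u - a) powr s * (B / (b - a) powr s)) has_integral
      ((b - c) powr (s + 1) / (s + 1) - (b - d) powr (s + 1) / (s + 1)) * (A / (b - a) powr s)
      + ((d - a) powr (s + 1) / (s + 1) - (c - a) powr (s + 1) / (s + 1)) * (B / (b - a) powr s)) {c..d}"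
    (is "(_ has_integral ?J) _")
    using assms
    by (intro has_integral_add has_integral_mult_left has_integral_powr_shift has_integral_powr_reflect)
      auto
  moreover have "?J = (b - a) / (s + 1) *
      ((((b - c) / (b - a)) powr (s + 1) - ((b - d) / (b - a)) powr (s + 1)) * A
       + (((d - a) / (b - a)) powr (s + 1) - ((c - a) / (b - a)) powr (s + 1)) * B)"
  proof -
    \<comment> \<open>Passing to ratios costs \<open>(b - a) powr (s + 1)\<close>; one factor
      \<open>b - a\<close> stays in front and the rest is the normalisation of the
      integrand.\<close>
    have e: "(b - a) / (s + 1) * (((y / (b - a)) powr (s + 1) - (z / (b - a)) powr (s + 1)) * C)
        = (y powr (s + 1) / (s + 1) - z powr (s + 1) / (s + 1)) * (C / (b - a) powr s)"
      if "y \<ge> 0" "z \<ge> 0" for y z C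
    proof -
      have "(b - a) powr (s + 1) = (b - a) powr s * (b - a)"
        using \<open>a < b\<close> by (simp add: powr_add)
      then show ?thesis
        using that \<open>a < b\<close> \<open>s > 0\<close> by (simp add: powr_divide divide_simps)
    qed
    show ?thesis
      unfolding distrib_left
      using e[of "b - c" "b - d" A] e[of "d - a" "c - a" B] assms by linarith
  qed
  moreover have "((b - u) / (b - a)) powr s * A + ((u - a) / (b - a)) powr s * B =
      (b - u) powr s * (A / (b - a) powr s) + (u - a) powr s * (B / (b - a) powr s)"
    if "u \<in> {c..d}" for u
    using that assms by (simp add: powr_divide)
  ultimately show ?thesis
    by (auto intro: has_integral_eq)
qed

lemma s_convex_on_segment:
  fixes g :: "real \<Rightarrow> real"
  assumes "s_convex_on s {a..b} g" "a < b" "u \<in> {a..b}"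
  shows "g u \<le> ((b - u) / (b - a)) powr s * g a + ((u - a) / (b - a)) powr s * g b"
proof -
  \<comment> \<open>The weight of \<open>a\<close> when \<open>u\<close> is written as a convex
    combination of \<open>a\<close> and \<open>b\<close>.\<close>
  define t where "t = (b - u) / (b - a)"
  have t: "t \<in> {0..1}" "1 - t = (u - a) / (b - a)"
    using assms by (auto simp: t_def field_simps)
  have "t * a + (1 - t) * b = b - t * (b - a)"
    by (simp add: algebra_simps)
  also have "\<dots> = u"
    using assms by (simp add: t_def)
  finally have "g u \<le> t powr s * g a + (1 - t) powr s * g b"
    using assms(1,2) t(1) unfolding s_convex_on_def
    by (metis atLeastAtMost_iff less_eq_real_def)
  then show ?thesis
    unfolding t(2) by (simp add: t_def)
qed

text \<open>One estimate for both pieces: \<open>w u = u - a\<close>, \<open>l = x - a\<close> on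
  \<open>{a..x}\<close>, and \<open>w u = b - u\<close>, \<open>l = b - x\<close> on
  \<open>{x..b}\<close>. Hoelder's inequality is applied to \<open>w\<close> and the continuous
  majorant of \<open>\<bar>g\<bar>\<close>, not to \<open>g\<close> itself.\<close>

lemma weighted_integral_bound:
  fixes w g :: "real \<Rightarrow> real"
  assumes "a < b" "a \<le> c" "c \<le> d" "d \<le> b" "s > 0"
    and pq: "p > 1" "q > 1" "1 / p + 1 / q = 1"
    and w: "continuous_on {c..d} w" "\<And>u. u \<in> {c..d} \<Longrightarrow> 0 \<le> w u"
    and wp: "((\<lambda>u. w u powr p) has_integral l powr (p + 1) / (p + 1)) {c..d}" and "l \<ge> 0"
    and int: "(\<lambda>u. w u * g u) integrable_on {c..d}"
    and conv: "s_convex_on s {a..b} (\<lambda>u. \<bar>g u\<bar> powr q)"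
  shows "\<bar>integral {c..d} (\<lambda>u. w u * g u)\<bar> \<le>
    (b - a)\<^sup>2 / ((p + 1) powr (1 / p) * (s + 1) powr (1 / q)) *
    ((l / (b - a)) powr (1 + 1 / p) *
      ((((b - c) / (b - a)) powr (s + 1) - ((b - d) / (b - a)) powr (s + 1)) * \<bar>g a\<bar> powr q
       + (((d - a) / (b - a)) powr (s + 1) - ((c - a) / (b - a)) powr (s + 1)) * \<bar>g b\<bar> powr q)
       powr (1 / q))"
proof -
  define G where "G u = ((b - u) / (b - a)) powr s * \<bar>g a\<bar> powr q + ((u - a) / (b - a)) powr s * \<bar>g b\<bar> powr q"
    for u
  define K where
    "K = (((b - c) / (b - a)) powr (s + 1) - ((b - d) / (b - a)) powr (s + 1)) * \<bar>g a\<bar> powr q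
       + (((d - a) / (b - a)) powr (s + 1) - ((c - a) / (b - a)) powr (s + 1)) * \<bar>g b\<bar> powr q"
  have G0: "G u \<ge> 0" for u
    by (simp add: G_def)
  have contG: "continuous_on {c..d} (\<lambda>u. G u powr (1 / q))"
    using assms G0 unfolding G_def by (intro continuous_on_powr' continuous_intros) auto
  have Gq: "(G u powr (1 / q)) powr q = G u" for u
    using pq G0 by (simp add: powr_powr)
  have dom: "norm (w u * g u) \<le> w u * G u powr (1 / q)" if "u \<in> {c..d}" for u
  proof -
    have "\<bar>g u\<bar> powr q \<le> G u"
      unfolding G_def using s_convex_on_segment[OF conv \<open>a < b\<close>, of u] that assms by auto
    then have "(\<bar>g u\<bar> powr q) powr (1 / q) \<le> G u powr (1 / q)"
      using pq by (intro powr_mono2) auto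
    then have "\<bar>g u\<bar> \<le> G u powr (1 / q)"
      using pq by (simp add: powr_powr)
    then show ?thesis
      using w(2)[OF that] by (simp add: abs_mult mult_left_mono)
  qed
  have "(G has_integral (b - a) / (s + 1) * K) {c..d}"
    unfolding G_def K_def using assms by (intro has_integral_s_convex_majorant) auto
  then have GK: "integral {c..d} G = (b - a) / (s + 1) * K" and "(b - a) / (s + 1) * K \<ge> 0"
    using has_integral_nonneg G0 by (blast intro: integral_unique)+
  \<comment> \<open>The sign comes from the integral of the nonnegative \<open>G\<close>; it serves
    to distribute the power \<open>1 / q\<close> over the product below.\<close>
  then have K0: "K \<ge> 0"
    using \<open>a < b\<close> \<open>s > 0\<close> by (simp add: zero_le_mult_iff zero_le_divide_iff)
  have "\<bar>integral {c..d} (\<lambda>u. w u * g u)\<bar> \<le> integral {c..d} (\<lambda>u. w u * G u powr (1 / q))"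
    using Henstock_Kurzweil_Integration.integral_norm_bound_integral[OF int _ dom]
    by (simp add: integrable_continuous_real continuous_on_mult w(1) contG)
  also have "\<dots> \<le> integral {c..d} (\<lambda>u. w u powr p) powr (1 / p) *
      integral {c..d} (\<lambda>u. (G u powr (1 / q)) powr q) powr (1 / q)"
    using assms contG by (intro Holder_integral_continuous) auto
  also have "\<dots> = (l powr (p + 1) / (p + 1)) powr (1 / p) * ((b - a) / (s + 1) * K) powr (1 / q)"
    using integral_unique[OF wp] GK by (simp add: Gq)
  also have "\<dots> = (b - a)\<^sup>2 / ((p + 1) powr (1 / p) * (s + 1) powr (1 / q)) *
      ((l / (b - a)) powr (1 + 1 / p) * K powr (1 / q))"
  proof -
    \<comment> \<open>Hoelder leaves \<open>(b - a) powr (1 / q)\<close>, and normalising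
      \<open>l\<close> by \<open>b - a\<close> contributes the exponent \<open>1 + 1 / p\<close>;
      conjugacy makes the total 2.\<close>
    have "(b - a) powr (1 + 1 / p) * (b - a) powr (1 / q) = (b - a) powr (1 + (1 / p + 1 / q))"
      by (simp add: powr_add)
    also have "\<dots> = (b - a)\<^sup>2"
      using \<open>a < b\<close> pq by simp
    finally have "(b - a) powr (1 / q) = (b - a)\<^sup>2 / (b - a) powr (1 + 1 / p)"
      using \<open>a < b\<close> by (simp add: field_simps)
    moreover have "(l powr (p + 1)) powr (1 / p) = l powr (1 + 1 / p)"
      using pq by (simp add: powr_powr add_divide_distrib)
    ultimately show ?thesis
      using \<open>a < b\<close> \<open>s > 0\<close> \<open>l \<ge> 0\<close> K0 pq by (simp add: powr_divide powr_mult mult_ac)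
  qed
  finally show ?thesis
    unfolding K_def .
qed

theorem theorem8:
  fixes I :: "real set" and a b p q s x :: real and f f' :: "real \<Rightarrow> real"
  assumes "is_interval I" and "I \<subseteq> {0..}"
    and "a \<in> I" and "b \<in> I" and "a < b"
    and "\<And>u. u \<in> interior I \<union> {a, b} \<Longrightarrow> (f has_real_derivative f' u) (at u within I)"
    and "f' absolutely_integrable_on {a..b}"
    and "p > 1" and "1 / p + 1 / q = 1"
    and "0 < s" and "s \<le> 1"
    and "s_convex_on s {a..b} (\<lambda>u. \<bar>f' u\<bar> powr q)"
    and "x \<in> {a..b}"
  shows "\<bar>f x - 1 / (b - a) * integral {a..b} f\<bar>
    \<le> (b - a) / ((p + 1) powr (1 / p) * (s + 1) powr (1 / q)) *
      (((b - x) / (b - a)) powr (1 + 1 / p) *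
         (((b - x) / (b - a)) powr (s + 1) * \<bar>f' a\<bar> powr q
          + (1 - ((x - a) / (b - a)) powr (s + 1)) * \<bar>f' b\<bar> powr q) powr (1 / q)
       + ((x - a) / (b - a)) powr (1 + 1 / p) *
         ((1 - ((b - x) / (b - a)) powr (s + 1)) * \<bar>f' a\<bar> powr q
          + ((x - a) / (b - a)) powr (s + 1) * \<bar>f' b\<bar> powr q) powr (1 / q))"
proof -
  have "1 / q > 0" "1 / q < 1"
    using \<open>1 / p + 1 / q = 1\<close> \<open>p > 1\<close> divide_less_eq_1_pos[of p 1] zero_less_divide_1_iff[of p] by linarith+
  then have "q > 1"
    by (simp add: divide_less_eq)
  have ab: "{a..b} \<subseteq> I"
    using mem_is_interval_1_I[OF \<open>is_interval I\<close> \<open>a \<in> I\<close> \<open>b \<in> I\<close>] by auto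
  then have "{a<..<b} \<subseteq> I"
    using greaterThanLessThan_subseteq_atLeastAtMost_iff[of a b a b] by blast
  \<comment> \<open>Hence all of \<open>{a..b}\<close> is covered by the differentiability
    hypothesis, and derivatives within \<open>I\<close> restrict to \<open>{a..b}\<close>.\<close>
  then have "{a<..<b} \<subseteq> interior I"
    by (simp add: interior_maximal)
  then have "u \<in> interior I \<union> {a, b}" if "u \<in> {a..b}" for u
    using that by (cases "u = a \<or> u = b") (auto simp: subset_eq)
  then have "(f has_real_derivative f' u) (at u within {a..b})" if "u \<in> {a..b}" for u
    using that ab by (intro DERIV_subset[OF assms(6)])
  note M = Montgomery_identity[OF \<open>x \<in> {a..b}\<close> this]
  have x: "a \<le> x" "x \<le> b"
    using \<open>x \<in> {a..b}\<close> by auto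
  define C where "C = (p + 1) powr (1 / p) * (s + 1) powr (1 / q)"
  \<comment> \<open>\<open>R\<close> bounds the integral over \<open>{x..b}\<close> and
    \<open>L\<close> the one over \<open>{a..x}\<close>, up to the factor
    \<open>(b - a)\<^sup>2 / C\<close>.\<close>
  define R where "R = ((b - x) / (b - a)) powr (1 + 1 / p) *
         (((b - x) / (b - a)) powr (s + 1) * \<bar>f' a\<bar> powr q
          + (1 - ((x - a) / (b - a)) powr (s + 1)) * \<bar>f' b\<bar> powr q) powr (1 / q)"
  define L where "L = ((x - a) / (b - a)) powr (1 + 1 / p) *
         ((1 - ((b - x) / (b - a)) powr (s + 1)) * \<bar>f' a\<bar> powr q
          + ((x - a) / (b - a)) powr (s + 1) * \<bar>f' b\<bar> powr q) powr (1 / q)"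
  \<comment> \<open>With \<open>c = a\<close> and \<open>d = x\<close>, the ratio
    \<open>(b - c) / (b - a)\<close> is 1 and \<open>(c - a) / (b - a)\<close> is 0, which turns the
    general brackets into those of \<open>L\<close>.\<close>
  have left: "\<bar>integral {a..x} (\<lambda>u. (u - a) * f' u)\<bar> \<le> (b - a)\<^sup>2 / C * L"
    using weighted_integral_bound[of a b a x s p q "\<lambda>u. u - a" "x - a" f'] assms x \<open>q > 1\<close> M(1)
      has_integral_powr_shift[of a a x p]
    by (simp add: C_def L_def continuous_on_diff)
  have right: "\<bar>integral {x..b} (\<lambda>u. (b - u) * f' u)\<bar> \<le> (b - a)\<^sup>2 / C * R"
    using weighted_integral_bound[of a b x b s p q "\<lambda>u. b - u" "b - x" f'] assms x \<open>q > 1\<close> M(2)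
      has_integral_powr_reflect[of x b b p]
    by (simp add: C_def R_def continuous_on_diff)
  have "f x - 1 / (b - a) * integral {a..b} f = ((b - a) * f x - integral {a..b} f) / (b - a)"
    using \<open>a < b\<close> by (simp add: field_simps)
  then have "\<bar>f x - 1 / (b - a) * integral {a..b} f\<bar> = \<bar>(b - a) * f x - integral {a..b} f\<bar> / (b - a)"
    using \<open>a < b\<close> by simp
  also have "\<dots> \<le> ((b - a)\<^sup>2 / C * (R + L)) / (b - a)"
  proof (rule divide_right_mono)
    \<comment> \<open>Triangle inequality for the difference in Montgomery's identity.\<close>
    show "\<bar>(b - a) * f x - integral {a..b} f\<bar> \<le> (b - a)\<^sup>2 / C * (R + L)"
      using left right M(3) unfolding distrib_left by linarith
  qed (use \<open>a < b\<close> in simp)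
  also have "\<dots> = (b - a) / C * (R + L)"
    using \<open>a < b\<close> by (simp add: power2_eq_square)
  finally show ?thesis
    unfolding C_def R_def L_def .
qed

end
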